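(* Let $K\ge 2$, let $(X,Y,Z^g)\sim P_t$ be random variables with $Y\in\{1,\dots,K\}$, and let $\boldsymbol\pi^g,\boldsymbol\pi^\ell$ be random vectors defined on the same probability space with values in the probability simplex $\Delta^{K-1}\subset\mathbb R^K$. With $\mathcal R_{\log}^{\star}$, $\mathcal R$, $\mathcal R_g$, $\mathcal R_\ell$, $\Delta=\mathcal R_\ell-\mathcal R_g$ and $D=\mathbb E_t\lVert\boldsymbol\pi^g-\boldsymbol\pi^\ell\rVert_2^2$ as defined in the context, and with $\boldsymbol\pi^\alpha=(1-\alpha)\boldsymbol\pi^g+\alpha\boldsymbol\pi^\ell$ for $\alpha\in[0,1]$, the following hold. (i) $\mathcal R_{\log}^{\star}(Z^g)-\mathcal R_{\log}^{\star}(Z^g,X)=I_t(Y;X\mid Z^g)\ge 0$, and this quantity is zero if and only if $Y$ and $X$ are conditionally independent given $Z^g$. (ii) For every $\alpha\in[0,1]$, $\mathcal R(\boldsymbol\pi^\alpha)-\mathcal R_g=\alpha(\Delta-D)+\alpha^2 D$. (iii) Suppose $\Delta\ge 0$. Then there exists $\alpha\in(0,1]$ with $\mathcal R(\boldsymbol\pi^\alpha)<\mathcal R_g$ if and only if $D>\Delta$. Moreover, if $D>\Delta$, then with $\alpha^\star=\frac{D-\Delta}{2D}$ one has $$\mathcal R_g-\mathcal R(\boldsymbol\pi^{\alpha^\star})=\frac{(D-\Delta)^2}{4D}>0 .$$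
   Context: $(X,Y,Z^g)\sim P_t$ describes a random node of a target graph: $X$ is its attribute vector (Euclidean-valued), $Y\in\{1,\dots,K\}$ its class label, and $Z^g$ is a random element (e.g. Euclidean-valued, or more generally taking values in a standard Borel space), namely the state available to a graph classifier after message passing. $\mathbb E_t$ denotes expectation under the target distribution, and $I_t(Y;X\mid Z^g)$ denotes conditional mutual information under $P_t$ (with the same logarithm, here natural, as in the log-risk). For any random input $S$ (such as $Z^g$ or the pair $(Z^g,X)$), the minimum achievable log-risk is $$\mathcal R_{\log}^{\star}(S)=\inf_q \mathbb E_t[-\log q(Y\mid S)],$$ where the infimum is over all measurable conditional probability mass functions $q(\cdot\mid s)$ on $\{1,\dots,K\}$, with the convention $-\log 0=+\infty$. For a random probability vector $\boldsymbol\pi\in\Delta^{K-1}=\{p\in\mathbb R^K: p_k\ge 0,\ \sum_k p_k=1\}$ (a predictive distribution for the label $Y$ of the same target node), the Brier risk is $$\mathcal R(\boldsymbol\pi)=\mathbb E_t\lVert \mathbf e_Y-\boldsymbol\pi\rVert_2^2,$$ where $\mathbf e_Y\in\mathbb R^K$ is the one-hot (standard basis) vector of the label $Y$. The vectors $\boldsymbol\pi^g$ and $\boldsymbol\pi^\ell$ are the predictive distributions of two predictors (a "graph-aware expert" and a "graph-free local expert") for the same target node. Write $\mathcal R_b=\mathcal R(\boldsymbol\pi^b)$ for $b\in\{g,\ell\}$, $\Delta=\mathcal R_\ell-\mathcal R_g$, and $D=\mathbb E_t\lVert\boldsymbol\pi^g-\boldsymbol\pi^\ell\rVert_2^2$.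 *)

theory Defs
  imports "HOL-Probability.Probability"
begin

definition standard_borel :: "'a measure \<Rightarrow> bool" where
  "standard_borel N \<longleftrightarrow>
    (\<exists>T. completely_metrizable_space T \<and> separable_space T \<and> topspace T = space N \<and>
         sets N = sigma_sets (topspace T) {U. openin T U})"

text \<open>
  The label set \<open>{1..K}\<close> is rendered by a finite index type \<open>'k\<close> with \<open>K = CARD('k)\<close>, so that
  probability vectors live in \<open>real ^ 'k\<close>.
\<close>

definition prob_simplex :: "(real ^ 'k::finite) set" where
  "prob_simplex = {p. (\<forall>k. 0 \<le> p $ k) \<and> (\<Sum>k\<in>UNIV. p $ k) = 1}"

definition cond_pmfs :: "'s measure \<Rightarrow> ('s \<Rightarrow> real ^ 'k::finite) set" where
  "cond_pmfs N = {q \<in> borel_measurable N. \<forall>s\<in>space N. q s \<in> prob_simplex}"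

text \<open>
  The convention \<open>- log 0 = \<infinity>\<close> has to be explicit, because \<open>ln 0 = 0\<close> in HOL. The function is only
  applied to arguments in \<open>[0, 1]\<close>, where \<open>- ln p\<close> is nonnegative.
\<close>

definition neg_log :: "real \<Rightarrow> ennreal" where
  "neg_log p = (if p = 0 then \<infinity> else ennreal (- ln p))"

definition log_risk ::
    "'w measure \<Rightarrow> ('w \<Rightarrow> 'k::finite) \<Rightarrow> ('w \<Rightarrow> 's) \<Rightarrow> ('s \<Rightarrow> real ^ 'k) \<Rightarrow> ennreal" where
  "log_risk P Y S q = (\<integral>\<^sup>+\<omega>. neg_log (q (S \<omega>) $ Y \<omega>) \<partial>P)"

definition min_log_risk ::
    "'w measure \<Rightarrow> 's measure \<Rightarrow> ('w \<Rightarrow> 'k::finite) \<Rightarrow> ('w \<Rightarrow> 's) \<Rightarrow> ennreal" where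
  "min_log_risk P N Y S = (INF q\<in>cond_pmfs N. log_risk P Y S q)"

text \<open>
  Conditional independence of \<open>A\<close> and \<open>B\<close> given \<open>C\<close>: conditional probabilities given the
  \<open>\<sigma>\<close>-algebra generated by \<open>C\<close> factorize almost surely, for each pair of events.
\<close>

definition cond_indep ::
    "'w measure \<Rightarrow> 'a measure \<Rightarrow> 'b measure \<Rightarrow> 'c measure \<Rightarrow>
     ('w \<Rightarrow> 'a) \<Rightarrow> ('w \<Rightarrow> 'b) \<Rightarrow> ('w \<Rightarrow> 'c) \<Rightarrow> bool" where
  "cond_indep P MA MB MC A B C \<longleftrightarrow>
    (let F = vimage_algebra (space P) C MC in
     \<forall>U\<in>sets MA. \<forall>V\<in>sets MB. AE \<omega> in P.
       real_cond_exp P F (\<lambda>\<omega>. indicator U (A \<omega>) * indicator V (B \<omega>)) \<omega> =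
       real_cond_exp P F (\<lambda>\<omega>. indicator U (A \<omega>)) \<omega> * real_cond_exp P F (\<lambda>\<omega>. indicator V (B \<omega>)) \<omega>)"

definition brier_risk ::
    "'w measure \<Rightarrow> ('w \<Rightarrow> 'k::finite) \<Rightarrow> ('w \<Rightarrow> real ^ 'k) \<Rightarrow> real" where
  "brier_risk P Y \<pi> = (\<integral>\<omega>. (norm (axis (Y \<omega>) 1 - \<pi> \<omega>))\<^sup>2 \<partial>P)"

definition mixture ::
    "real \<Rightarrow> ('w \<Rightarrow> real ^ 'k::finite) \<Rightarrow> ('w \<Rightarrow> real ^ 'k) \<Rightarrow> 'w \<Rightarrow> real ^ 'k" where
  "mixture \<alpha> \<pi>g \<pi>l = (\<lambda>\<omega>. (1 - \<alpha>) *\<^sub>R \<pi>g \<omega> + \<alpha> *\<^sub>R \<pi>l \<omega>)"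

end

theory Submission
  imports Defs
begin

text \<open>
  Let \<open>\<eta>\<close> be a regular version of the conditional law of \<open>Y\<close> given the input \<open>S\<close>. The log-risk of \<open>q\<close> is
  the expected cross entropy of \<open>\<eta>(S)\<close> and \<open>q(S)\<close>, so by the pointwise Gibbs inequality \<open>\<eta>\<close> is the
  unique minimizer up to null sets, and the minimal risk is at most \<open>K\<close>. Since \<open>\<eta>\<^sub>k(s) / P(Y = k)\<close> is the
  density of the joint law of \<open>(Y, S)\<close> with respect to the product of its marginals, the mutual
  information of \<open>Y\<close> and \<open>S\<close> is the entropy of \<open>Y\<close> minus the minimal log-risk; taking
  \<open>S = (X, Z)\<close> and \<open>S = Z\<close> and subtracting gives the identity in (i). The difference vanishes iff the
  posterior given \<open>Z\<close> is already optimal given \<open>(X, Z)\<close>, that is, iff the two posteriors agree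
  almost surely, which is conditional independence. Parts (ii) and (iii) expand the squared norm.
\<close>

section \<open>Elementary facts on the simplex, and measurability\<close>

lemma prob_simplex_nonneg: "p \<in> prob_simplex \<Longrightarrow> 0 \<le> p $ k"
  by (simp add: prob_simplex_def)

lemma prob_simplex_sum: "p \<in> prob_simplex \<Longrightarrow> (\<Sum>k\<in>UNIV. p $ k) = 1"
  by (simp add: prob_simplex_def)

lemma prob_simplex_le_1:
  assumes "p \<in> prob_simplex"
  shows "p $ k \<le> 1"
proof -
  have "p $ k \<le> (\<Sum>k\<in>UNIV. p $ k)"
    using assms by (intro member_le_sum) (auto simp: prob_simplex_def)
  then show ?thesis using assms by (simp add: prob_simplex_sum)
qed

lemma cond_pmfs_measurable: "q \<in> cond_pmfs N \<Longrightarrow> q \<in> borel_measurable N"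
  by (simp add: cond_pmfs_def)

lemma cond_pmfs_simplex: "q \<in> cond_pmfs N \<Longrightarrow> s \<in> space N \<Longrightarrow> q s \<in> prob_simplex"
  by (simp add: cond_pmfs_def)

lemma measurable_vec_nth [measurable (raw)]:
  fixes f :: "'a \<Rightarrow> real ^ 'k::finite"
  assumes "f \<in> borel_measurable M"
  shows "(\<lambda>x. f x $ k) \<in> borel_measurable M"
  using assms by (rule borel_measurable_continuous_on[rotated]) (intro continuous_intros)

lemma measurable_neg_log [measurable]: "neg_log \<in> borel_measurable borel"
  unfolding neg_log_def by measurable

subsection \<open>Cross entropy\<close>

text \<open>Computed in \<open>ennreal\<close>, where \<open>0 * \<infinity> = 0\<close>: a label of
  \<open>p\<close>-mass zero contributes nothing, while a label of positive \<open>p\<close>-mass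
  that \<open>q\<close> excludes makes the value infinite.\<close>

definition cross_entropy :: "real ^ 'k::finite \<Rightarrow> real ^ 'k \<Rightarrow> ennreal" where
  "cross_entropy p q = (\<Sum>k\<in>UNIV. ennreal (p $ k) * neg_log (q $ k))"

text \<open>This is \<open>ln x \<le> x - 1\<close> at \<open>x = q / p\<close>, multiplied by
  \<open>p\<close>; equality holds only at \<open>x = 1\<close>. For \<open>p = 0\<close> the
  right-hand side is \<open>0\<close> and the claims are immediate from
  \<open>q \<ge> 0\<close>.\<close>

lemma gibbs_term:
  fixes p q :: real
  assumes "0 \<le> p" "0 \<le> q" "p > 0 \<Longrightarrow> q > 0"
  shows "p - q \<le> p * ln p - p * ln q"
    and "p - q = p * ln p - p * ln q \<Longrightarrow> p = q"
proof -
  have *: "p * ln p - p * ln q = - p * ln (q / p)" if "p > 0"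
    using that assms by (simp add: ln_div algebra_simps)
  show "p - q \<le> p * ln p - p * ln q"
  proof (cases "p = 0")
    case False
    then have "p > 0" "q > 0" using assms by auto
    then have "p * ln (q / p) \<le> p * (q / p - 1)"
      by (intro mult_left_mono ln_le_minus_one) auto
    then show ?thesis using * \<open>p > 0\<close> by (simp add: algebra_simps)
  qed (use assms in auto)
  show "p = q" if eq: "p - q = p * ln p - p * ln q"
  proof (cases "p = 0")
    case False
    then have "p > 0" "q > 0" using assms by auto
    then have "p * ln (q / p) = p * (q / p - 1)"
      using eq * by (simp add: algebra_simps)
    then have "ln (q / p) = q / p - 1" using \<open>p > 0\<close> by simp
    then have "q / p = 1" using \<open>p > 0\<close> \<open>q > 0\<close> by (intro ln_eq_minus_one) auto
    then show ?thesis using \<open>p > 0\<close> by simp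
  qed (use eq in auto)
qed

text \<open>The support condition excludes infinite summands, so the value is an ordinary real sum,
  in which differences can be formed.\<close>

lemma cross_entropy_real:
  assumes p: "p \<in> prob_simplex" and q: "q \<in> prob_simplex" and pq: "\<And>k. p $ k > 0 \<Longrightarrow> q $ k > 0"
  shows "cross_entropy p q = ennreal (\<Sum>k\<in>UNIV. - (p $ k * ln (q $ k)))"
proof -
  have nn: "0 \<le> - (p $ k * ln (q $ k))" for k
  proof (cases "p $ k = 0")
    case False
    then have "q $ k > 0" "p $ k > 0"
      using pq[of k] prob_simplex_nonneg[OF p, of k] by auto
    then show ?thesis
      using prob_simplex_le_1[OF q, of k] by (simp add: mult_nonneg_nonpos)
  qed simp
  have "ennreal (p $ k) * neg_log (q $ k) = ennreal (- (p $ k * ln (q $ k)))" for k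
  proof (cases "p $ k = 0")
    case False
    then have "q $ k > 0" "p $ k > 0"
      using pq[of k] prob_simplex_nonneg[OF p, of k] by auto
    then show ?thesis
      by (simp add: neg_log_def ennreal_mult'[symmetric])
  qed simp
  then show ?thesis
    unfolding cross_entropy_def by (simp only: sum_ennreal[OF nn])
qed

text \<open>Each summand is at most \<open>1 - p $ k\<close> by \<open>gibbs_term\<close> with
  \<open>q = 1\<close>. The bound is crude, but it serves only to give finiteness.\<close>

lemma cross_entropy_self_le:
  fixes p :: "real ^ 'k::finite"
  assumes p: "p \<in> prob_simplex"
  shows "cross_entropy p p \<le> ennreal CARD('k)"
proof -
  have "- (p $ k * ln (p $ k)) \<le> 1" for k
    using gibbs_term(1)[of "p $ k" 1] prob_simplex_nonneg[OF p, of k] by simp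
  then have "(\<Sum>k\<in>UNIV. - (p $ k * ln (p $ k))) \<le> (\<Sum>k\<in>(UNIV::'k set). 1)"
    by (intro sum_mono) blast
  then show ?thesis
    using cross_entropy_real[OF p p] by (simp add: ennreal_leI)
qed

text \<open>If \<open>q\<close> charges the support of \<open>p\<close>, the gap is the sum of the
  nonnegative termwise defects \<open>d k\<close>; their linear parts \<open>p $ k - q $ k\<close>
  cancel because both vectors sum to one. Otherwise \<open>cross_entropy p q\<close> is infinite
  while \<open>cross_entropy p p\<close> is finite.\<close>

lemma gibbs:
  fixes p q :: "real ^ 'k::finite"
  assumes p: "p \<in> prob_simplex" and q: "q \<in> prob_simplex"
  shows "cross_entropy p p \<le> cross_entropy p q"
    and "cross_entropy p p = cross_entropy p q \<Longrightarrow> p = q"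
proof -
  have "cross_entropy p p \<le> cross_entropy p q \<and> (cross_entropy p p = cross_entropy p q \<longrightarrow> p = q)"
  proof (cases "\<forall>k. p $ k > 0 \<longrightarrow> q $ k > 0")
    case True
    define d where "d k = p $ k * ln (p $ k) - p $ k * ln (q $ k) - (p $ k - q $ k)" for k
    have d: "0 \<le> d k" "d k = 0 \<Longrightarrow> p $ k = q $ k" for k
      using gibbs_term[of "p $ k" "q $ k"] True prob_simplex_nonneg[OF p, of k]
        prob_simplex_nonneg[OF q, of k]
      by (auto simp: d_def)
    have eq: "(\<Sum>k\<in>UNIV. - (p $ k * ln (q $ k))) = (\<Sum>k\<in>UNIV. - (p $ k * ln (p $ k))) + (\<Sum>k\<in>UNIV. d k)"
      unfolding d_def using p q
      by (simp add: sum.distrib sum_subtractf sum_negf prob_simplex_sum)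
    have cpq: "cross_entropy p q = ennreal (\<Sum>k\<in>UNIV. - (p $ k * ln (q $ k)))"
      using True by (intro cross_entropy_real p q) auto
    have cpp: "cross_entropy p p = ennreal (\<Sum>k\<in>UNIV. - (p $ k * ln (p $ k)))"
      by (intro cross_entropy_real p) auto
    have nn: "0 \<le> (\<Sum>k\<in>UNIV. - (p $ k * ln (p $ k)))"
      using prob_simplex_nonneg[OF p] prob_simplex_le_1[OF p]
      by (intro sum_nonneg) (metis ln_le_zero_iff mult_nonneg_nonpos neg_0_le_iff_le less_eq_real_def mult_zero_left)
    have dn: "0 \<le> (\<Sum>k\<in>UNIV. d k)" using d by (intro sum_nonneg) auto
    have "p = q" if "cross_entropy p p = cross_entropy p q"
    proof -
      have "(\<Sum>k\<in>UNIV. d k) = 0"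
        using that nn dn unfolding cpp cpq eq by (simp add: sum_nonneg)
      then have "\<forall>k. d k = 0" using d(1) by (simp add: sum_nonneg_eq_0_iff)
      then show ?thesis using d(2) by (simp add: vec_eq_iff)
    qed
    then show ?thesis
      using dn unfolding cpp cpq eq by (auto intro!: ennreal_leI)
  next
    case False
    then obtain k where k: "p $ k > 0" "q $ k = 0"
      using prob_simplex_nonneg[OF q] by (metis less_eq_real_def)
    then have "ennreal (p $ k) * neg_log (q $ k) = \<infinity>"
      by (simp add: neg_log_def ennreal_mult_eq_top_iff)
    then have "cross_entropy p q = \<infinity>"
      using member_le_sum[of k UNIV "\<lambda>k. ennreal (p $ k) * neg_log (q $ k)"]
      by (simp add: cross_entropy_def top_unique)
    then show ?thesis
      using cross_entropy_self_le[OF p] by (auto simp: top_unique)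
  qed
  then show "cross_entropy p p \<le> cross_entropy p q"
    and "cross_entropy p p = cross_entropy p q \<Longrightarrow> p = q" by auto
qed

subsection \<open>Brier risk of a mixture\<close>

lemma simplex_norm_le:
  fixes p :: "real ^ 'k::finite"
  assumes "p \<in> prob_simplex"
  shows "norm p \<le> 1"
proof -
  have "norm p \<le> (\<Sum>k\<in>UNIV. \<bar>p $ k\<bar>)" by (rule norm_le_l1_cart)
  also have "\<dots> = (\<Sum>k\<in>UNIV. p $ k)" using assms by (simp add: prob_simplex_nonneg)
  finally show ?thesis using assms by (simp add: prob_simplex_sum)
qed

lemma axis_in_simplex: "axis k 1 \<in> (prob_simplex :: (real ^ 'k::finite) set)"
  by (simp add: prob_simplex_def axis_def)

text \<open>The vector inside the norm is \<open>(1 - \<alpha>) *\<^sub>R (e - a) + \<alpha>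
  *\<^sub>R (e - b)\<close>; polarization expresses its cross term through the three squared
  distances.\<close>

lemma norm_mixture:
  fixes e a b :: "'a::real_inner"
  shows "(norm (e - ((1 - \<alpha>) *\<^sub>R a + \<alpha> *\<^sub>R b)))\<^sup>2 =
    (norm (e - a))\<^sup>2 + \<alpha> * ((norm (e - b))\<^sup>2 - (norm (e - a))\<^sup>2 - (norm (a - b))\<^sup>2)
      + \<alpha>\<^sup>2 * (norm (a - b))\<^sup>2"
  unfolding power2_norm_eq_inner
  by (simp add: inner_simps inner_commute power2_eq_square algebra_simps)

context prob_space
begin

text \<open>The simplex lies in the unit ball, so the integrand is at most 4. Integrability is what
  permits splitting the Bochner integral of \<open>norm_mixture\<close> linearly.\<close>

lemma integrable_simplex_dist:
  fixes f g :: "'a \<Rightarrow> real ^ 'k::finite"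
  assumes [measurable]: "f \<in> borel_measurable M" "g \<in> borel_measurable M"
    and f: "\<forall>\<omega>\<in>space M. f \<omega> \<in> prob_simplex" and g: "\<forall>\<omega>\<in>space M. g \<omega> \<in> prob_simplex"
  shows "integrable M (\<lambda>\<omega>. (norm (f \<omega> - g \<omega>))\<^sup>2)"
proof (rule integrable_const_bound[where B="2\<^sup>2"])
  show "AE \<omega> in M. norm ((norm (f \<omega> - g \<omega>))\<^sup>2) \<le> 2\<^sup>2"
  proof (rule AE_I2)
    fix \<omega> assume "\<omega> \<in> space M"
    then have "norm (f \<omega> - g \<omega>) \<le> 2"
      using norm_triangle_ineq4[of "f \<omega>" "g \<omega>"] simplex_norm_le f g by (smt (verit))
    then show "norm ((norm (f \<omega> - g \<omega>))\<^sup>2) \<le> 2\<^sup>2"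
      using power_mono[of "norm (f \<omega> - g \<omega>)" 2 2] by simp
  qed
qed simp

lemma brier_risk_mixture:
  fixes \<pi>g \<pi>l :: "'a \<Rightarrow> real ^ 'k::finite" and Y :: "'a \<Rightarrow> 'k"
  assumes Y: "Y \<in> measurable M (count_space UNIV)"
    and g: "\<pi>g \<in> borel_measurable M" "\<forall>\<omega>\<in>space M. \<pi>g \<omega> \<in> prob_simplex"
    and l: "\<pi>l \<in> borel_measurable M" "\<forall>\<omega>\<in>space M. \<pi>l \<omega> \<in> prob_simplex"
    and D: "D = (\<integral>\<omega>. (norm (\<pi>g \<omega> - \<pi>l \<omega>))\<^sup>2 \<partial>M)"
  shows "brier_risk M Y (mixture \<alpha> \<pi>g \<pi>l) - brier_risk M Y \<pi>g =
    \<alpha> * (brier_risk M Y \<pi>l - brier_risk M Y \<pi>g - D) + \<alpha>\<^sup>2 * D"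
proof -
  have ax: "(\<lambda>\<omega>. axis (Y \<omega>) 1 :: real ^ 'k) \<in> borel_measurable M"
    by (rule measurable_compose[OF Y]) simp
  note int = integrable_simplex_dist[OF ax g(1) _ g(2)] integrable_simplex_dist[OF ax l(1) _ l(2)]
    integrable_simplex_dist[OF g(1) l(1) g(2) l(2)]
  show ?thesis
    unfolding brier_risk_def mixture_def norm_mixture D
    using int by (simp add: axis_in_simplex algebra_simps)
qed

end

section \<open>The quadratic in the mixing weight\<close>

text \<open>The weight is the vertex of the parabola; the two assumptions give \<open>D > 0\<close>,
  so the divisions are genuine.\<close>

lemma quadratic_gain:
  fixes \<Delta> D :: real
  assumes "0 \<le> \<Delta>" "\<Delta> < D"
  shows "(D - \<Delta>) / (2 * D) * (\<Delta> - D) + ((D - \<Delta>) / (2 * D))\<^sup>2 * D = - ((D - \<Delta>)\<^sup>2 / (4 * D))"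
    and "(D - \<Delta>)\<^sup>2 / (4 * D) > 0"
proof -
  show "(D - \<Delta>) / (2 * D) * (\<Delta> - D) + ((D - \<Delta>) / (2 * D))\<^sup>2 * D = - ((D - \<Delta>)\<^sup>2 / (4 * D))"
    using assms by (simp add: field_simps power2_eq_square)
  show "(D - \<Delta>)\<^sup>2 / (4 * D) > 0" using assms by simp
qed

text \<open>If \<open>D \<le> \<Delta>\<close>, both terms are nonnegative for positive weights.
  Otherwise the vertex is a witness, and \<open>0 \<le> \<Delta>\<close> keeps it at most
  1/2.\<close>

lemma quadratic_gain_iff:
  fixes \<Delta> D :: real
  assumes "0 \<le> D" "0 \<le> \<Delta>"
  shows "(\<exists>\<alpha>\<in>{0<..1}. \<alpha> * (\<Delta> - D) + \<alpha>\<^sup>2 * D < 0) \<longleftrightarrow> D > \<Delta>"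
proof
  assume "\<exists>\<alpha>\<in>{0<..1}. \<alpha> * (\<Delta> - D) + \<alpha>\<^sup>2 * D < 0"
  then obtain \<alpha> where "0 < \<alpha>" "\<alpha> * (\<Delta> - D) + \<alpha>\<^sup>2 * D < 0" by auto
  moreover have "0 \<le> \<alpha> * (\<Delta> - D)" if "D \<le> \<Delta>" using that \<open>0 < \<alpha>\<close> by simp
  moreover have "0 \<le> \<alpha>\<^sup>2 * D" using assms by simp
  ultimately show "D > \<Delta>" by linarith
next
  assume "D > \<Delta>"
  then have "(D - \<Delta>) / (2 * D) \<in> {0<..1}" using assms by (simp add: field_simps)
  then show "\<exists>\<alpha>\<in>{0<..1}. \<alpha> * (\<Delta> - D) + \<alpha>\<^sup>2 * D < 0"
    using quadratic_gain[OF assms(2) \<open>D > \<Delta>\<close>] by (metis neg_less_0_iff_less)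
qed

subsection \<open>Posterior label distribution\<close>

text \<open>
  \<open>\<eta>\<close> is a version of the conditional law of \<open>Y\<close> given \<open>S\<close>, stated without conditional expectations as
  \<open>P(Y = k, S \<in> ds) = \<eta>\<^sub>k(s) P(S \<in> ds)\<close>.
\<close>

definition posterior ::
    "'w measure \<Rightarrow> 's measure \<Rightarrow> ('w \<Rightarrow> 'k::finite) \<Rightarrow> ('w \<Rightarrow> 's) \<Rightarrow> ('s \<Rightarrow> real ^ 'k) \<Rightarrow> bool" where
  "posterior P N Y S \<eta> \<longleftrightarrow> \<eta> \<in> cond_pmfs N \<and>
    (\<forall>k. distr (density P (\<lambda>\<omega>. indicator {k} (Y \<omega>))) N S = density (distr P N S) (\<lambda>s. ennreal (\<eta> s $ k)))"

lemma measurable_vec_lambda: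
  fixes f :: "'a \<Rightarrow> 'k::finite \<Rightarrow> real"
  assumes "\<And>k. (\<lambda>x. f x k) \<in> borel_measurable M"
  shows "(\<lambda>x. \<chi> k. f x k) \<in> borel_measurable M"
  using assms by (subst borel_measurable_euclidean_space) (auto simp: Basis_vec_def inner_axis)

lemma sum_indicator_singleton:
  fixes g :: "'k::finite \<Rightarrow> 'b::semiring_1"
  shows "(\<Sum>k\<in>UNIV. indicator {k} y * g k) = g y"
proof -
  have "(\<Sum>k\<in>UNIV. indicator {k} y * g k) = (\<Sum>k\<in>UNIV. if y = k then g k else 0)"
    by (intro sum.cong) (auto simp: indicator_def)
  then show ?thesis by simp
qed

context prob_space
begin

text \<open>Conditioning on \<open>S\<close> replaces the label by its posterior average. The
  integral is split over the events \<open>Y = k\<close>, and on each the defining identity of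
  \<open>posterior\<close> changes variables. It is applied below to log losses and to
  indicators.\<close>

lemma nn_integral_posterior:
  fixes Y :: "'a \<Rightarrow> 'k::finite" and g :: "'k \<Rightarrow> 's \<Rightarrow> ennreal"
  assumes Y [measurable]: "Y \<in> measurable M (count_space UNIV)"
    and S [measurable]: "S \<in> measurable M N"
    and \<eta>: "posterior M N Y S \<eta>"
    and g [measurable]: "\<And>k. g k \<in> borel_measurable N"
  shows "(\<integral>\<^sup>+\<omega>. g (Y \<omega>) (S \<omega>) \<partial>M) = (\<integral>\<^sup>+\<omega>. (\<Sum>k\<in>UNIV. ennreal (\<eta> (S \<omega>) $ k) * g k (S \<omega>)) \<partial>M)"
proof -
  have [measurable]: "\<eta> \<in> borel_measurable N"
    using \<eta> by (simp add: posterior_def cond_pmfs_def)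
  have *: "(\<integral>\<^sup>+\<omega>. indicator {k} (Y \<omega>) * g k (S \<omega>) \<partial>M) = (\<integral>\<^sup>+\<omega>. ennreal (\<eta> (S \<omega>) $ k) * g k (S \<omega>) \<partial>M)" for k
  proof -
    have "(\<integral>\<^sup>+\<omega>. indicator {k} (Y \<omega>) * g k (S \<omega>) \<partial>M) =
        (\<integral>\<^sup>+s. g k s \<partial>distr (density M (\<lambda>\<omega>. indicator {k} (Y \<omega>))) N S)"
      by (simp add: nn_integral_distr nn_integral_density)
    also have "\<dots> = (\<integral>\<^sup>+s. g k s \<partial>density (distr M N S) (\<lambda>s. ennreal (\<eta> s $ k)))"
      using \<eta> by (simp add: posterior_def)
    also have "\<dots> = (\<integral>\<^sup>+\<omega>. ennreal (\<eta> (S \<omega>) $ k) * g k (S \<omega>) \<partial>M)"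
      by (simp add: nn_integral_distr nn_integral_density)
    finally show ?thesis .
  qed
  have "(\<integral>\<^sup>+\<omega>. g (Y \<omega>) (S \<omega>) \<partial>M) = (\<integral>\<^sup>+\<omega>. (\<Sum>k\<in>UNIV. indicator {k} (Y \<omega>) * g k (S \<omega>)) \<partial>M)"
    by (simp only: sum_indicator_singleton)
  also have "\<dots> = (\<Sum>k\<in>UNIV. \<integral>\<^sup>+\<omega>. indicator {k} (Y \<omega>) * g k (S \<omega>) \<partial>M)"
    by (intro nn_integral_sum) measurable
  also have "\<dots> = (\<Sum>k\<in>UNIV. \<integral>\<^sup>+\<omega>. ennreal (\<eta> (S \<omega>) $ k) * g k (S \<omega>) \<partial>M)"
    by (simp only: *)
  also have "\<dots> = (\<integral>\<^sup>+\<omega>. (\<Sum>k\<in>UNIV. ennreal (\<eta> (S \<omega>) $ k) * g k (S \<omega>)) \<partial>M)"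
    by (intro nn_integral_sum[symmetric]) measurable
  finally show ?thesis .
qed

text \<open>Each \<open>\<nu> k\<close>, the law of \<open>S\<close> restricted to
  \<open>Y = k\<close>, is dominated by the law \<open>\<mu>\<close> of \<open>S\<close>, so
  Radon-Nikodym derivatives exist; they only have to be normalized on a null set.\<close>

lemma posterior_exists:
  fixes Y :: "'a \<Rightarrow> 'k::finite"
  assumes Y [measurable]: "Y \<in> measurable M (count_space UNIV)"
    and S [measurable]: "S \<in> measurable M N"
  obtains \<eta> where "posterior M N Y S \<eta>"
proof -
  define \<mu> where "\<mu> = distr M N S"
  define \<nu> where "\<nu> k = distr (density M (\<lambda>\<omega>. indicator {k} (Y \<omega>))) N S" for k
  interpret \<mu>: prob_space \<mu> unfolding \<mu>_def by (rule prob_space_distr) simp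
  have sets [measurable_cong, simp]: "sets \<mu> = sets N" "sets (\<nu> k) = sets N" for k
    by (simp_all add: \<mu>_def \<nu>_def)
  have \<nu>: "emeasure (\<nu> k) B = (\<integral>\<^sup>+\<omega>. indicator {k} (Y \<omega>) * indicator B (S \<omega>) \<partial>M)"
    if [measurable]: "B \<in> sets N" for k B
  proof -
    have "emeasure (\<nu> k) B = (\<integral>\<^sup>+s. indicator B s \<partial>\<nu> k)" by simp
    also have "\<dots> = (\<integral>\<^sup>+\<omega>. indicator {k} (Y \<omega>) * indicator B (S \<omega>) \<partial>M)"
      unfolding \<nu>_def by (subst nn_integral_distr) (simp_all add: nn_integral_density del: nn_integral_indicator)
    finally show ?thesis .
  qed
  have \<mu>: "emeasure \<mu> B = (\<integral>\<^sup>+\<omega>. indicator B (S \<omega>) \<partial>M)" if [measurable]: "B \<in> sets N" for B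
  proof -
    have "emeasure \<mu> B = (\<integral>\<^sup>+s. indicator B s \<partial>\<mu>)" by simp
    also have "\<dots> = (\<integral>\<^sup>+\<omega>. indicator B (S \<omega>) \<partial>M)"
      unfolding \<mu>_def by (subst nn_integral_distr) (simp_all del: nn_integral_indicator)
    finally show ?thesis .
  qed
  have le: "emeasure (\<nu> k) B \<le> emeasure \<mu> B" if "B \<in> sets N" for k B
    unfolding \<nu>[OF that] \<mu>[OF that] by (intro nn_integral_mono) (auto simp: indicator_def)
  have ac: "absolutely_continuous \<mu> (\<nu> k)" for k
    unfolding absolutely_continuous_def
  proof
    fix B assume "B \<in> null_sets \<mu>"
    then show "B \<in> null_sets (\<nu> k)" using le[of B k] by (auto simp: null_sets_def)
  qed
  have fin: "finite_measure (\<nu> k)" for k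
    using le[of "space N" k] \<mu>.emeasure_finite[of "space N"] sets_eq_imp_space_eq[OF sets(2)]
    by (intro finite_measureI) (auto simp: top_unique)
  have "\<exists>D. D \<in> borel_measurable N \<and> density \<mu> (\<lambda>s. ennreal (D s)) = \<nu> k \<and> (\<forall>s. 0 \<le> D s)" for k
  proof -
    obtain D where D: "D \<in> borel_measurable \<mu>" "AE s in \<mu>. RN_deriv \<mu> (\<nu> k) s = ennreal (D s)" "\<And>s. 0 \<le> D s"
      using \<mu>.real_RN_deriv[OF fin[of k] ac[of k]] by auto
    have "density \<mu> (\<lambda>s. ennreal (D s)) = density \<mu> (RN_deriv \<mu> (\<nu> k))"
      using D by (intro density_cong) auto
    also have "\<dots> = \<nu> k" by (rule \<mu>.density_RN_deriv[OF ac]) simp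
    finally have "density \<mu> (\<lambda>s. ennreal (D s)) = \<nu> k" .
    moreover have "D \<in> borel_measurable N" using D(1) by (simp cong: measurable_cong_sets)
    ultimately show ?thesis using D(3) by blast
  qed
  then obtain D where D [measurable]: "\<And>k. D k \<in> borel_measurable N"
    and dens: "\<And>k. density \<mu> (\<lambda>s. ennreal (D k s)) = \<nu> k" and nn: "\<And>k s. 0 \<le> D k s"
    by metis
  \<comment> \<open>The events \<open>Y = k\<close> partition the space, so the measures
    \<open>\<nu> k\<close> add up to \<open>\<mu>\<close>, and uniqueness of densities gives sum
    one.\<close>
  have "AE s in \<mu>. ennreal (\<Sum>k\<in>UNIV. D k s) = 1"
  proof (rule \<mu>.density_unique)
    show "density \<mu> (\<lambda>s. ennreal (\<Sum>k\<in>UNIV. D k s)) = density \<mu> (\<lambda>_. 1)"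
    proof (rule measure_eqI)
      fix B assume "B \<in> sets (density \<mu> (\<lambda>s. ennreal (\<Sum>k\<in>UNIV. D k s)))"
      then have B [measurable]: "B \<in> sets N" by simp
      have "emeasure (density \<mu> (\<lambda>s. ennreal (\<Sum>k\<in>UNIV. D k s))) B =
          (\<integral>\<^sup>+s. (\<Sum>k\<in>UNIV. ennreal (D k s) * indicator B s) \<partial>\<mu>)"
        by (simp add: emeasure_density sum_distrib_right[symmetric] sum_ennreal nn)
      also have "\<dots> = (\<Sum>k\<in>UNIV. emeasure (density \<mu> (\<lambda>s. ennreal (D k s))) B)"
        by (subst nn_integral_sum) (simp_all add: emeasure_density)
      also have "\<dots> = (\<Sum>k\<in>UNIV. \<integral>\<^sup>+\<omega>. indicator {k} (Y \<omega>) * indicator B (S \<omega>) \<partial>M)"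
        by (simp add: dens \<nu>)
      also have "\<dots> = (\<integral>\<^sup>+\<omega>. (\<Sum>k\<in>UNIV. indicator {k} (Y \<omega>) * indicator B (S \<omega>)) \<partial>M)"
        by (rule nn_integral_sum[symmetric]) measurable
      also have "\<dots> = emeasure \<mu> B"
        by (simp only: sum_indicator_singleton \<mu>[OF B])
      finally show "emeasure (density \<mu> (\<lambda>s. ennreal (\<Sum>k\<in>UNIV. D k s))) B = emeasure (density \<mu> (\<lambda>_. 1)) B"
        by (simp add: density_1)
    qed simp
  qed simp_all
  then have sum1: "AE s in \<mu>. (\<Sum>k\<in>UNIV. D k s) = 1"
    by eventually_elim simp
  \<comment> \<open>On the exceptional null set a vertex of the simplex at an arbitrary label is
    substituted, because \<open>cond_pmfs\<close> demands simplex values everywhere.\<close>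
  define \<eta> where "\<eta> s = (if (\<Sum>k\<in>UNIV. D k s) = 1 then (\<chi> k. D k s) else axis undefined 1)" for s
  have \<eta>_meas [measurable]: "\<eta> \<in> borel_measurable N"
    unfolding \<eta>_def by (intro measurable_If measurable_vec_lambda) measurable
  have "density \<mu> (\<lambda>s. ennreal (\<eta> s $ k)) = \<nu> k" for k
  proof -
    have "density \<mu> (\<lambda>s. ennreal (\<eta> s $ k)) = density \<mu> (\<lambda>s. ennreal (D k s))"
    proof (rule density_cong)
      show "AE s in \<mu>. ennreal (\<eta> s $ k) = ennreal (D k s)"
        using sum1 by eventually_elim (simp add: \<eta>_def)
    qed measurable
    then show ?thesis by (simp add: dens)
  qed
  moreover have "\<eta> s \<in> prob_simplex" for s
    using nn axis_in_simplex by (auto simp: \<eta>_def prob_simplex_def)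
  ultimately have "posterior M N Y S \<eta>"
    by (simp add: posterior_def cond_pmfs_def \<mu>_def \<nu>_def)
  then show ?thesis by (rule that)
qed

section \<open>Minimizing the log-risk\<close>

text \<open>Averaging the loss over the posterior makes the minimization over \<open>q\<close> a
  pointwise one.\<close>

lemma log_risk_posterior:
  fixes Y :: "'a \<Rightarrow> 'k::finite"
  assumes Y: "Y \<in> measurable M (count_space UNIV)" and S: "S \<in> measurable M N"
    and \<eta>: "posterior M N Y S \<eta>" and q: "q \<in> cond_pmfs N"
  shows "log_risk M Y S q = (\<integral>\<^sup>+\<omega>. cross_entropy (\<eta> (S \<omega>)) (q (S \<omega>)) \<partial>M)"
proof -
  have [measurable]: "q \<in> borel_measurable N" using q by (rule cond_pmfs_measurable)
  show ?thesis
    unfolding log_risk_def cross_entropy_def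
    by (rule nn_integral_posterior[OF Y S \<eta>, where g="\<lambda>k s. neg_log (q s $ k)"]) measurable
qed

lemma log_risk_posterior_finite:
  fixes Y :: "'a \<Rightarrow> 'k::finite"
  assumes Y: "Y \<in> measurable M (count_space UNIV)" and S: "S \<in> measurable M N"
    and \<eta>: "posterior M N Y S \<eta>"
  shows "log_risk M Y S \<eta> < \<infinity>"
proof -
  have c: "\<eta> \<in> cond_pmfs N" using \<eta> by (simp add: posterior_def)
  have "log_risk M Y S \<eta> \<le> (\<integral>\<^sup>+\<omega>. ennreal CARD('k) \<partial>M)"
    unfolding log_risk_posterior[OF Y S \<eta> c]
    using measurable_space[OF S] cond_pmfs_simplex[OF c]
    by (intro nn_integral_mono cross_entropy_self_le) auto
  also have "\<dots> < \<infinity>" by (simp add: emeasure_space_1)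
  finally show ?thesis .
qed

text \<open>Integrating the pointwise Gibbs inequality shows that \<open>\<eta>\<close>, itself a
  candidate, attains the infimum.\<close>

lemma min_log_risk_eq_posterior:
  fixes Y :: "'a \<Rightarrow> 'k::finite"
  assumes Y: "Y \<in> measurable M (count_space UNIV)" and S: "S \<in> measurable M N"
    and \<eta>: "posterior M N Y S \<eta>"
  shows "min_log_risk M N Y S = log_risk M Y S \<eta>"
proof -
  have c: "\<eta> \<in> cond_pmfs N" using \<eta> by (simp add: posterior_def)
  have "log_risk M Y S \<eta> \<le> log_risk M Y S q" if "q \<in> cond_pmfs N" for q
    unfolding log_risk_posterior[OF Y S \<eta> c] log_risk_posterior[OF Y S \<eta> that]
    using measurable_space[OF S] cond_pmfs_simplex[OF c] cond_pmfs_simplex[OF that]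
    by (intro nn_integral_mono gibbs) auto
  then show ?thesis
    unfolding min_log_risk_def using c by (intro antisym INF_lower INF_greatest) auto
qed

text \<open>Equal risks force the nonnegative Gibbs gap to have integral zero, hence to vanish
  almost surely; the equality case of \<open>gibbs\<close> then applies. Finiteness of the risk of
  \<open>\<eta>\<close> justifies the subtraction.\<close>

lemma log_risk_minimal_iff:
  fixes Y :: "'a \<Rightarrow> 'k::finite"
  assumes Y: "Y \<in> measurable M (count_space UNIV)" and S [measurable]: "S \<in> measurable M N"
    and \<eta>: "posterior M N Y S \<eta>" and q: "q \<in> cond_pmfs N"
  shows "log_risk M Y S q = log_risk M Y S \<eta> \<longleftrightarrow> (AE \<omega> in M. q (S \<omega>) = \<eta> (S \<omega>))"
proof -
  have c: "\<eta> \<in> cond_pmfs N" using \<eta> by (simp add: posterior_def)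
  have [measurable]: "q \<in> borel_measurable N" "\<eta> \<in> borel_measurable N"
    using q c by (auto intro: cond_pmfs_measurable)
  have [measurable]: "(\<lambda>\<omega>. cross_entropy (\<eta> (S \<omega>)) (q (S \<omega>))) \<in> borel_measurable M"
    "(\<lambda>\<omega>. cross_entropy (\<eta> (S \<omega>)) (\<eta> (S \<omega>))) \<in> borel_measurable M"
    unfolding cross_entropy_def by measurable
  have simplex: "\<eta> (S \<omega>) \<in> prob_simplex" "q (S \<omega>) \<in> prob_simplex" if "\<omega> \<in> space M" for \<omega>
    using measurable_space[OF S that] cond_pmfs_simplex[OF q] cond_pmfs_simplex[OF c] by simp_all
  let ?f = "\<lambda>\<omega>. cross_entropy (\<eta> (S \<omega>)) (q (S \<omega>))" and ?g = "\<lambda>\<omega>. cross_entropy (\<eta> (S \<omega>)) (\<eta> (S \<omega>))"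
  note risk = log_risk_posterior[OF Y S \<eta> q] log_risk_posterior[OF Y S \<eta> c]
  have fin: "(\<integral>\<^sup>+\<omega>. ?g \<omega> \<partial>M) \<noteq> \<infinity>"
    using log_risk_posterior_finite[OF Y S \<eta>] unfolding risk by auto
  have le: "AE \<omega> in M. ?g \<omega> \<le> ?f \<omega>"
    using simplex by (intro AE_I2 gibbs) auto
  show ?thesis
  proof
    assume "log_risk M Y S q = log_risk M Y S \<eta>"
    then have "(\<integral>\<^sup>+\<omega>. ?f \<omega> - ?g \<omega> \<partial>M) = 0"
      unfolding risk using le fin by (subst nn_integral_diff) auto
    then have "AE \<omega> in M. ?f \<omega> - ?g \<omega> = 0"
      by (subst (asm) nn_integral_0_iff_AE) auto
    then show "AE \<omega> in M. q (S \<omega>) = \<eta> (S \<omega>)"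
      using le AE_space
    proof eventually_elim
      case (elim \<omega>)
      have "?g \<omega> < \<infinity>"
        using cross_entropy_self_le[OF simplex(1)[OF elim(3)]] by (auto simp: less_top[symmetric] top_unique)
      then have "?g \<omega> = ?f \<omega>"
        using elim(1,2) by (metis diff_eq_0_iff_ennreal leD order_le_less)
      then show ?case using gibbs(2)[OF simplex[OF elim(3)]] by simp
    qed
  next
    assume "AE \<omega> in M. q (S \<omega>) = \<eta> (S \<omega>)"
    then show "log_risk M Y S q = log_risk M Y S \<eta>"
      unfolding risk by (intro nn_integral_cong_AE) (auto elim: eventually_mono)
  qed
qed

text \<open>Data processing: composing with \<open>f\<close> turns every predictor from
  \<open>f S\<close> into a predictor from \<open>S\<close> of the same risk.\<close>

lemma min_log_risk_compose_le:
  fixes Y :: "'a \<Rightarrow> 'k::finite"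
  assumes f: "f \<in> measurable N N'" and S: "S \<in> measurable M N"
  shows "min_log_risk M N Y S \<le> min_log_risk M N' Y (\<lambda>\<omega>. f (S \<omega>))"
  unfolding min_log_risk_def
proof (rule INF_greatest)
  fix q :: "_ \<Rightarrow> real ^ 'k" assume q: "q \<in> cond_pmfs N'"
  have "(\<lambda>s. q (f s)) \<in> cond_pmfs N"
    using q measurable_space[OF f] measurable_compose[OF f] by (auto simp: cond_pmfs_def)
  then show "(INF q\<in>cond_pmfs N. log_risk M Y S q) \<le> log_risk M Y (\<lambda>\<omega>. f (S \<omega>)) q"
    by (rule INF_lower2) (simp add: log_risk_def)
qed

end

subsection \<open>Mutual information with a label\<close>

context prob_space
begin

text \<open>The mutual information is the expected log of the density \<open>f\<close> of the joint
  law with respect to the product law. Splitting that log yields the entropy of \<open>Y\<close>,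
  which is independent of \<open>S\<close>, minus the risk of the posterior. Base
  \<open>exp 1\<close> matches the natural logarithm in the risk.\<close>

lemma mutual_information_posterior:
  fixes Y :: "'a \<Rightarrow> 'k::finite"
  assumes Y [measurable]: "Y \<in> measurable M (count_space UNIV)"
    and S [measurable]: "S \<in> measurable M N"
  shows "mutual_information (exp 1) (count_space UNIV) N Y S =
    (\<integral>\<omega>. - ln (prob (Y -` {Y \<omega>} \<inter> space M)) \<partial>M) - enn2real (min_log_risk M N Y S)"
proof -
  obtain \<eta> where \<eta>: "posterior M N Y S \<eta>" using posterior_exists[OF Y S] .
  then have c: "\<eta> \<in> cond_pmfs N" by (simp add: posterior_def)
  then have [measurable]: "\<eta> \<in> borel_measurable N" by (rule cond_pmfs_measurable)
  have simplex: "\<eta> (S \<omega>) \<in> prob_simplex" if "\<omega> \<in> space M" for \<omega>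
    using measurable_space[OF S that] cond_pmfs_simplex[OF c] by simp
  define p where "p k = prob (Y -` {k} \<inter> space M)" for k
  have p_nn: "0 \<le> p k" for k by (simp add: p_def)
  interpret dY: prob_space "distr M (count_space UNIV) Y" by (rule prob_space_distr) simp
  interpret dS: prob_space "distr M N S" by (rule prob_space_distr) simp
  interpret pair: pair_prob_space "distr M (count_space UNIV) Y" "distr M N S" ..
  let ?Q = "distr M (count_space UNIV) Y \<Otimes>\<^sub>M distr M N S"
  let ?J = "distr M (count_space UNIV \<Otimes>\<^sub>M N) (\<lambda>\<omega>. (Y \<omega>, S \<omega>))"
  \<comment> \<open>Density of the joint law of \<open>(Y, S)\<close> with respect to the product of the marginals. Where
    \<open>p k = 0\<close>, HOL's division gives \<open>0\<close>, consistently with \<open>\<eta> s $ k = 0\<close> almost surely.\<close>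
  define f where "f = (\<lambda>(k, s). \<eta> s $ k / p k)"
  have f_meas [measurable]: "f \<in> borel_measurable (count_space UNIV \<Otimes>\<^sub>M N)"
    unfolding f_def by (rule measurable_pair_measure_countable1) auto
  have sets_Q: "sets ?Q = sets (count_space UNIV \<Otimes>\<^sub>M N)"
    by (intro sets_pair_measure_cong) auto
  have f_measQ [measurable]: "f \<in> borel_measurable ?Q"
    using f_meas by (simp only: measurable_cong_sets[OF sets_Q refl])
  have marginal: "(\<integral>\<^sup>+\<omega>. g (Y \<omega>) \<partial>M) = (\<Sum>k\<in>UNIV. ennreal (p k) * g k)" for g :: "'k \<Rightarrow> ennreal"
  proof -
    have "(\<integral>\<^sup>+\<omega>. g (Y \<omega>) \<partial>M) = (\<integral>\<^sup>+\<omega>. (\<Sum>k\<in>UNIV. indicator {k} (Y \<omega>) * g k) \<partial>M)"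
      by (simp only: sum_indicator_singleton)
    also have "\<dots> = (\<Sum>k\<in>UNIV. \<integral>\<^sup>+\<omega>. indicator {k} (Y \<omega>) * g k \<partial>M)"
      by (rule nn_integral_sum) measurable
    also have "\<dots> = (\<Sum>k\<in>UNIV. ennreal (p k) * g k)"
    proof (intro sum.cong refl)
      fix k
      have "(\<integral>\<^sup>+\<omega>. indicator {k} (Y \<omega>) * g k \<partial>M) =
          (\<integral>\<^sup>+\<omega>. indicator (Y -` {k} \<inter> space M) \<omega> * g k \<partial>M)"
        by (intro nn_integral_cong) (auto simp: indicator_def)
      also have "\<dots> = ennreal (p k) * g k"
        by (subst nn_integral_multc) (auto simp: p_def emeasure_eq_measure)
      finally show "(\<integral>\<^sup>+\<omega>. indicator {k} (Y \<omega>) * g k \<partial>M) = ennreal (p k) * g k" .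
    qed
    finally show ?thesis .
  qed
  \<comment> \<open>The expectation of \<open>\<eta> (S \<omega>) $ k\<close> is the probability of
    \<open>Y = k\<close>, so a label of probability zero has almost surely vanishing posterior
    mass.\<close>
  have \<eta>_null: "AE \<omega> in M. \<eta> (S \<omega>) $ k = 0" if "p k = 0" for k
  proof -
    have "(\<integral>\<^sup>+\<omega>. ennreal (\<eta> (S \<omega>) $ k) \<partial>M) = (\<integral>\<^sup>+\<omega>. indicator {k} (Y \<omega>) \<partial>M)"
      using nn_integral_posterior[OF Y S \<eta>, of "\<lambda>j s. indicator {k} j"]
      by (simp add: sum_indicator_singleton indicator_def if_distrib cong: if_cong)
    also have "\<dots> = 0"
      using marginal[of "indicator {k}"] that by (simp add: indicator_def if_distrib cong: if_cong)
    finally have "AE \<omega> in M. ennreal (\<eta> (S \<omega>) $ k) = 0"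
      by (subst (asm) nn_integral_0_iff_AE) auto
    then show ?thesis using AE_space
      by eventually_elim (use prob_simplex_nonneg[OF simplex] in \<open>force simp: ennreal_eq_0_iff intro: antisym\<close>)
  qed
  \<comment> \<open>On a measurable \<open>A\<close>, the posterior average gives a sum over labels;
    extracting the weight \<open>p k\<close> from each term leaves an iterated integral against the
    product law.\<close>
  have J: "?J = density ?Q (\<lambda>x. ennreal (f x))"
  proof (rule measure_eqI)
    show "sets ?J = sets (density ?Q (\<lambda>x. ennreal (f x)))"
      by (simp add: sets_Q)
    fix A assume "A \<in> sets ?J"
    then have A [measurable]: "A \<in> sets (count_space UNIV \<Otimes>\<^sub>M N)" by simp
    have A': "A \<in> sets ?Q" using A by (simp only: sets_Q)
    have [measurable]: "(\<lambda>s. indicator A (k, s) :: ennreal) \<in> borel_measurable N" for k by measurable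
    have "emeasure ?J A = (\<integral>\<^sup>+x. indicator A x \<partial>?J)" by simp
    also have "\<dots> = (\<integral>\<^sup>+\<omega>. indicator A (Y \<omega>, S \<omega>) \<partial>M)"
      by (subst nn_integral_distr) (simp_all del: nn_integral_indicator)
    also have "\<dots> = (\<integral>\<^sup>+\<omega>. (\<Sum>k\<in>UNIV. ennreal (\<eta> (S \<omega>) $ k) * indicator A (k, S \<omega>)) \<partial>M)"
      by (rule nn_integral_posterior[OF Y S \<eta>, where g="\<lambda>k s. indicator A (k, s)"]) measurable
    also have "\<dots> = (\<Sum>k\<in>UNIV. \<integral>\<^sup>+\<omega>. ennreal (\<eta> (S \<omega>) $ k) * indicator A (k, S \<omega>) \<partial>M)"
      by (rule nn_integral_sum) measurable
    also have "\<dots> = (\<Sum>k\<in>UNIV. ennreal (p k) * (\<integral>\<^sup>+\<omega>. ennreal (f (k, S \<omega>)) * indicator A (k, S \<omega>) \<partial>M))"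
    proof (intro sum.cong refl)
      fix k
      show "(\<integral>\<^sup>+\<omega>. ennreal (\<eta> (S \<omega>) $ k) * indicator A (k, S \<omega>) \<partial>M) =
          ennreal (p k) * (\<integral>\<^sup>+\<omega>. ennreal (f (k, S \<omega>)) * indicator A (k, S \<omega>) \<partial>M)"
      proof (cases "p k = 0")
        case True
        have "(\<integral>\<^sup>+\<omega>. ennreal (\<eta> (S \<omega>) $ k) * indicator A (k, S \<omega>) \<partial>M) = (\<integral>\<^sup>+\<omega>. 0 \<partial>M)"
          using \<eta>_null[OF True] by (intro nn_integral_cong_AE) auto
        then show ?thesis using True by simp
      next
        case False
        then have "ennreal (\<eta> s $ k) = ennreal (p k) * ennreal (f (k, s))" for s
          using p_nn[of k] by (simp add: f_def ennreal_mult'[symmetric])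
        then show ?thesis
          by (subst nn_integral_cmult[symmetric]) (simp_all add: mult.assoc)
      qed
    qed
    also have "\<dots> = (\<integral>\<^sup>+k. (\<integral>\<^sup>+s. ennreal (f (k, s)) * indicator A (k, s) \<partial>distr M N S)
        \<partial>distr M (count_space UNIV) Y)"
      using marginal[of "\<lambda>k. \<integral>\<^sup>+\<omega>. ennreal (f (k, S \<omega>)) * indicator A (k, S \<omega>) \<partial>M"]
      by (simp add: nn_integral_distr)
    also have "\<dots> = (\<integral>\<^sup>+x. ennreal (f x) * indicator A x \<partial>?Q)"
      using A' by (intro dS.nn_integral_fst) measurable
    also have "\<dots> = emeasure (density ?Q (\<lambda>x. ennreal (f x))) A"
      using A' by (simp add: emeasure_density)
    finally show "emeasure ?J A = emeasure (density ?Q (\<lambda>x. ennreal (f x))) A" .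
  qed
  have f_nn: "AE x in ?Q. 0 \<le> f x"
    using cond_pmfs_simplex[OF c] p_nn
    by (intro AE_I2) (auto simp: f_def space_pair_measure intro!: divide_nonneg_nonneg prob_simplex_nonneg)
  have MI: "mutual_information (exp 1) (count_space UNIV) N Y S = (\<integral>\<omega>. ln (f (Y \<omega>, S \<omega>)) \<partial>M)"
  proof -
    have "mutual_information (exp 1) (count_space UNIV) N Y S = (\<integral>x. f x * log (exp 1) (f x) \<partial>?Q)"
      unfolding mutual_information_def J using f_nn by (intro pair.KL_density) auto
    also have "\<dots> = (\<integral>x. ln (f x) \<partial>density ?Q (\<lambda>x. ennreal (f x)))"
      using f_nn by (subst integral_real_density) (auto simp: log_def)
    also have "\<dots> = (\<integral>\<omega>. ln (f (Y \<omega>, S \<omega>)) \<partial>M)"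
      unfolding J[symmetric] by (subst integral_distr) auto
    finally show ?thesis .
  qed
  \<comment> \<open>This and \<open>\<eta>_pos\<close> below make both arguments positive almost
    surely, so that the logarithm of the quotient splits.\<close>
  have p_pos: "AE \<omega> in M. p (Y \<omega>) \<noteq> 0"
  proof -
    have "(\<integral>\<^sup>+\<omega>. indicator {k. p k = 0} (Y \<omega>) \<partial>M) = 0"
      unfolding marginal by (auto simp: indicator_def)
    then show ?thesis by (subst (asm) nn_integral_0_iff_AE) (auto simp: indicator_def)
  qed
  have meas1 [measurable]: "(\<lambda>\<omega>. \<eta> (S \<omega>) $ Y \<omega>) \<in> borel_measurable M"
    using measurable_compose[OF Y, of "\<lambda>k. k"]
    by (rule measurable_compose_countable[where g=Y, rotated]) auto
  have risk: "min_log_risk M N Y S = (\<integral>\<^sup>+\<omega>. neg_log (\<eta> (S \<omega>) $ Y \<omega>) \<partial>M)"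
    using min_log_risk_eq_posterior[OF Y S \<eta>] by (simp add: log_risk_def)
  have risk_fin: "(\<integral>\<^sup>+\<omega>. neg_log (\<eta> (S \<omega>) $ Y \<omega>) \<partial>M) \<noteq> \<infinity>"
    using log_risk_posterior_finite[OF Y S \<eta>] by (simp add: log_risk_def)
  \<comment> \<open>The finite risk excludes the value \<open>\<infinity>\<close> that
    \<open>neg_log\<close> takes at zero.\<close>
  then have "AE \<omega> in M. neg_log (\<eta> (S \<omega>) $ Y \<omega>) \<noteq> \<infinity>"
    by (intro nn_integral_PInf_AE) auto
  then have \<eta>_pos: "AE \<omega> in M. \<eta> (S \<omega>) $ Y \<omega> \<noteq> 0"
    by eventually_elim (auto simp: neg_log_def)
  have ln_nonpos: "ln (\<eta> (S \<omega>) $ Y \<omega>) \<le> 0" if "\<omega> \<in> space M" for \<omega>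
    using prob_simplex_nonneg[OF simplex[OF that]] prob_simplex_le_1[OF simplex[OF that]]
    by (metis ln_0 ln_le_zero_iff order_le_less order_refl)
  have risk': "min_log_risk M N Y S = (\<integral>\<^sup>+\<omega>. ennreal (- ln (\<eta> (S \<omega>) $ Y \<omega>)) \<partial>M)"
    unfolding risk using \<eta>_pos by (intro nn_integral_cong_AE) (auto simp: neg_log_def)
  have int_\<eta>: "integrable M (\<lambda>\<omega>. - ln (\<eta> (S \<omega>) $ Y \<omega>))"
    using ln_nonpos risk risk_fin risk' by (intro integrableI_nonneg) (auto simp: less_top)
  have eq_\<eta>: "enn2real (min_log_risk M N Y S) = (\<integral>\<omega>. - ln (\<eta> (S \<omega>) $ Y \<omega>) \<partial>M)"
    unfolding risk' using ln_nonpos by (subst integral_eq_nn_integral) auto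
  have int_p: "integrable M (\<lambda>\<omega>. - ln (p (Y \<omega>)))"
  proof (rule integrable_const_bound)
    show "AE \<omega> in M. norm (- ln (p (Y \<omega>))) \<le> Max (range (\<lambda>k. \<bar>ln (p k)\<bar>))"
      by (intro AE_I2) (auto intro!: Max_ge)
  qed measurable
  have "(\<integral>\<omega>. ln (f (Y \<omega>, S \<omega>)) \<partial>M) = (\<integral>\<omega>. - ln (p (Y \<omega>)) - (- ln (\<eta> (S \<omega>) $ Y \<omega>)) \<partial>M)"
  proof (rule integral_cong_AE)
    show "AE \<omega> in M. ln (f (Y \<omega>, S \<omega>)) = - ln (p (Y \<omega>)) - (- ln (\<eta> (S \<omega>) $ Y \<omega>))"
      using p_pos \<eta>_pos AE_space
    proof eventually_elim
      case (elim \<omega>)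
      then show ?case
        using p_nn[of "Y \<omega>"] prob_simplex_nonneg[OF simplex, of \<omega> "Y \<omega>"]
        by (simp add: f_def ln_div)
    qed
  qed measurable
  also have "\<dots> = (\<integral>\<omega>. - ln (p (Y \<omega>)) \<partial>M) - enn2real (min_log_risk M N Y S)"
    unfolding eq_\<eta> using int_p int_\<eta> by (rule Bochner_Integration.integral_diff)
  finally show ?thesis unfolding MI p_def .
qed

lemma min_log_risk_finite:
  fixes Y :: "'a \<Rightarrow> 'k::finite"
  assumes Y: "Y \<in> measurable M (count_space UNIV)" and S: "S \<in> measurable M N"
  shows "min_log_risk M N Y S < \<infinity>"
  using posterior_exists[OF Y S] min_log_risk_eq_posterior[OF Y S] log_risk_posterior_finite[OF Y S]
  by metis

end

subsection \<open>Conditional independence\<close>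

context prob_space
begin

lemma subalgebra_vimage:
  assumes "S \<in> measurable M N"
  shows "subalgebra M (vimage_algebra (space M) S N)"
  using assms unfolding subalgebra_def
  by (auto simp: measurable_iff_sets)

lemma sigma_finite_subalgebra_vimage:
  assumes "S \<in> measurable M N"
  shows "sigma_finite_subalgebra M (vimage_algebra (space M) S N)"
  using subalgebra_vimage[OF assms]
  by (intro finite_measure_subalgebra_is_sigma_finite)
    (simp add: finite_measure_subalgebra_def finite_measure_subalgebra_axioms_def finite_measure_axioms)

lemma measurable_vimage_algebra_compose:
  assumes S: "S \<in> measurable M N" and "f \<in> measurable N L"
  shows "(\<lambda>\<omega>. f (S \<omega>)) \<in> measurable (vimage_algebra (space M) S N) L"
  using measurable_space[OF S]
  by (intro measurable_compose[OF measurable_vimage_algebra1 assms(2)]) auto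

lemma posterior_integrable:
  assumes S [measurable]: "S \<in> measurable M N" and q: "q \<in> cond_pmfs N"
  shows "integrable M (\<lambda>\<omega>. \<Sum>k\<in>U. q (S \<omega>) $ k)"
proof (intro Bochner_Integration.integrable_sum integrable_const_bound[where B=1])
  fix k
  have [measurable]: "q \<in> borel_measurable N" using q by (rule cond_pmfs_measurable)
  show "(\<lambda>\<omega>. q (S \<omega>) $ k) \<in> borel_measurable M" by measurable
  show "AE \<omega> in M. norm (q (S \<omega>) $ k) \<le> 1"
    using prob_simplex_nonneg[OF cond_pmfs_simplex[OF q]] prob_simplex_le_1[OF cond_pmfs_simplex[OF q]]
      measurable_space[OF S]
    by (intro AE_I2) auto
qed

text \<open>Links the density form of the posterior to conditional expectations. Sets of the
  generated sigma-algebra are preimages under \<open>S\<close>, so the defining integral identity is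
  \<open>nn_integral_posterior\<close> for a product of indicators.\<close>

lemma real_cond_exp_label:
  fixes Y :: "'a \<Rightarrow> 'k::finite" and \<eta> :: "'s \<Rightarrow> real ^ 'k"
  assumes Y [measurable]: "Y \<in> measurable M (count_space UNIV)" and S [measurable]: "S \<in> measurable M N"
    and \<eta>: "posterior M N Y S \<eta>"
  shows "AE \<omega> in M. real_cond_exp M (vimage_algebra (space M) S N) (\<lambda>\<omega>. indicator U (Y \<omega>)) \<omega> =
    (\<Sum>k\<in>U. \<eta> (S \<omega>) $ k)"
proof -
  interpret F: sigma_finite_subalgebra M "vimage_algebra (space M) S N"
    using S by (rule sigma_finite_subalgebra_vimage)
  have c: "\<eta> \<in> cond_pmfs N" using \<eta> by (simp add: posterior_def)
  then have [measurable]: "\<eta> \<in> borel_measurable N" by (rule cond_pmfs_measurable)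
  have nn: "0 \<le> \<eta> (S \<omega>) $ k" if "\<omega> \<in> space M" for \<omega> k
    using measurable_space[OF S that] prob_simplex_nonneg[OF cond_pmfs_simplex[OF c]] by simp
  have meas: "(\<lambda>s. \<Sum>k\<in>U. \<eta> s $ k) \<in> borel_measurable N" by measurable
  show ?thesis
  proof (rule F.real_cond_exp_charact)
    show "integrable M (\<lambda>\<omega>. indicator U (Y \<omega>) :: real)"
      by (rule integrable_const_bound[where B=1]) (auto simp: indicator_def)
    show "integrable M (\<lambda>\<omega>. \<Sum>k\<in>U. \<eta> (S \<omega>) $ k)"
      by (rule posterior_integrable[OF S c])
    show "(\<lambda>\<omega>. \<Sum>k\<in>U. \<eta> (S \<omega>) $ k) \<in> borel_measurable (vimage_algebra (space M) S N)"
      by (rule measurable_vimage_algebra_compose[OF S meas])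
    fix A assume "A \<in> sets (vimage_algebra (space M) S N)"
    then obtain B where B [measurable]: "B \<in> sets N" and A: "A = S -` B \<inter> space M"
      using measurable_space[OF S] by (auto simp: sets_vimage_algebra2)
    have "(\<integral>\<^sup>+\<omega>. ennreal (indicator A \<omega> * indicator U (Y \<omega>)) \<partial>M) =
        (\<integral>\<^sup>+\<omega>. indicator U (Y \<omega>) * indicator B (S \<omega>) \<partial>M)"
      by (intro nn_integral_cong) (auto simp: A indicator_def)
    also have "\<dots> = (\<integral>\<^sup>+\<omega>. (\<Sum>k\<in>UNIV. ennreal (\<eta> (S \<omega>) $ k) * (indicator U k * indicator B (S \<omega>))) \<partial>M)"
      by (rule nn_integral_posterior[OF Y S \<eta>, where g="\<lambda>k s. indicator U k * indicator B s"]) measurable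
    also have "\<dots> = (\<integral>\<^sup>+\<omega>. ennreal (indicator A \<omega> * (\<Sum>k\<in>U. \<eta> (S \<omega>) $ k)) \<partial>M)"
    proof (intro nn_integral_cong)
      fix \<omega> assume \<omega>: "\<omega> \<in> space M"
      have "(\<Sum>k\<in>UNIV. ennreal (\<eta> (S \<omega>) $ k) * (indicator U k * indicator B (S \<omega>))) =
          (\<Sum>k\<in>U. ennreal (\<eta> (S \<omega>) $ k) * indicator B (S \<omega>))"
        by (rule sum.mono_neutral_cong_right) auto
      also have "\<dots> = ennreal (\<Sum>k\<in>U. \<eta> (S \<omega>) $ k) * indicator B (S \<omega>)"
        using nn[OF \<omega>] by (simp add: sum_distrib_right[symmetric] sum_ennreal)
      also have "\<dots> = ennreal (indicator A \<omega> * (\<Sum>k\<in>U. \<eta> (S \<omega>) $ k))"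
        using \<omega> by (auto simp: A indicator_def)
      finally show "(\<Sum>k\<in>UNIV. ennreal (\<eta> (S \<omega>) $ k) * (indicator U k * indicator B (S \<omega>))) =
          ennreal (indicator A \<omega> * (\<Sum>k\<in>U. \<eta> (S \<omega>) $ k))" .
    qed
    finally have eq: "(\<integral>\<^sup>+\<omega>. ennreal (indicator A \<omega> * indicator U (Y \<omega>)) \<partial>M) =
        (\<integral>\<^sup>+\<omega>. ennreal (indicator A \<omega> * (\<Sum>k\<in>U. \<eta> (S \<omega>) $ k)) \<partial>M)" .
    have [measurable]: "A \<in> sets M" unfolding A by measurable
    show "(\<integral>\<omega>\<in>A. indicator U (Y \<omega>) \<partial>M) = (\<integral>\<omega>\<in>A. (\<Sum>k\<in>U. \<eta> (S \<omega>) $ k) \<partial>M)"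
      unfolding set_lebesgue_integral_def real_scaleR_def
      using eq nn by (subst (1 2) integral_eq_nn_integral) (auto intro!: sum_nonneg mult_nonneg_nonneg)
  qed
qed

text \<open>If the posteriors agree, factorization follows from the tower property through the
  sigma-algebra of \<open>(X, Z)\<close>. Conversely, factorization makes \<open>\<zeta>\<close> a
  posterior given \<open>(X, Z)\<close> too, and uniqueness of densities identifies it with
  \<open>\<eta>\<close>.\<close>

lemma cond_indep_posterior_iff:
  fixes Y :: "'a \<Rightarrow> 'k::finite"
  assumes Y [measurable]: "Y \<in> measurable M (count_space UNIV)"
    and X [measurable]: "X \<in> measurable M MX" and Z [measurable]: "Z \<in> measurable M MZ"
    and \<eta>: "posterior M (MX \<Otimes>\<^sub>M MZ) Y (\<lambda>\<omega>. (X \<omega>, Z \<omega>)) \<eta>" and \<zeta>: "posterior M MZ Y Z \<zeta>"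
  shows "cond_indep M (count_space UNIV) MX MZ Y X Z \<longleftrightarrow> (AE \<omega> in M. \<zeta> (Z \<omega>) = \<eta> (X \<omega>, Z \<omega>))"
proof -
  define S where "S = (\<lambda>\<omega>. (X \<omega>, Z \<omega>))"
  define N where "N = MX \<Otimes>\<^sub>M MZ"
  define F where "F = vimage_algebra (space M) Z MZ"
  define G where "G = vimage_algebra (space M) S N"
  have S [measurable]: "S \<in> measurable M N" unfolding S_def N_def by measurable
  have snd_S: "snd (S \<omega>) = Z \<omega>" for \<omega> by (simp add: S_def)
  have snd [measurable]: "snd \<in> measurable N MZ" and fst [measurable]: "fst \<in> measurable N MX"
    unfolding N_def by measurable
  interpret F: sigma_finite_subalgebra M F
    unfolding F_def by (rule sigma_finite_subalgebra_vimage[OF Z])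
  interpret G: sigma_finite_subalgebra M G
    unfolding G_def by (rule sigma_finite_subalgebra_vimage[OF S])
  have MG: "subalgebra M G" unfolding G_def by (rule subalgebra_vimage[OF S])
  have Z_G: "Z \<in> measurable G MZ" and X_G: "X \<in> measurable G MX"
    using measurable_vimage_algebra_compose[OF S snd] measurable_vimage_algebra_compose[OF S fst]
    by (simp_all add: S_def G_def)
  have GF: "subalgebra G F"
    using Z_G unfolding subalgebra_def F_def by (auto simp: measurable_iff_sets G_def)
  have \<eta>c: "\<eta> \<in> cond_pmfs N" and \<zeta>c: "\<zeta> \<in> cond_pmfs MZ"
    using \<eta> \<zeta> by (simp_all add: posterior_def N_def)
  have [measurable]: "\<eta> \<in> borel_measurable N" "\<zeta> \<in> borel_measurable MZ"
    using \<eta>c \<zeta>c by (auto intro: cond_pmfs_measurable)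
  have \<eta>S: "posterior M N Y S \<eta>" using \<eta> by (simp add: N_def S_def)
  have ceF: "AE \<omega> in M. real_cond_exp M F (\<lambda>\<omega>. indicator U (Y \<omega>)) \<omega> = (\<Sum>k\<in>U. \<zeta> (Z \<omega>) $ k)" for U
    unfolding F_def by (rule real_cond_exp_label[OF Y Z \<zeta>])
  have ceG: "AE \<omega> in M. real_cond_exp M G (\<lambda>\<omega>. indicator U (Y \<omega>)) \<omega> = (\<Sum>k\<in>U. \<eta> (S \<omega>) $ k)" for U
    unfolding G_def by (rule real_cond_exp_label[OF Y S \<eta>S])
  have intY: "integrable M (\<lambda>\<omega>. indicator U (Y \<omega>) * indicator V (X \<omega>) :: real)"
    if [measurable]: "V \<in> sets MX" for U V
    by (rule integrable_const_bound[where B=1]) (auto simp: indicator_def)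
  have \<zeta>_F: "(\<lambda>\<omega>. \<Sum>k\<in>U. \<zeta> (Z \<omega>) $ k) \<in> borel_measurable F" for U
    unfolding F_def by (rule measurable_vimage_algebra_compose[OF Z]) measurable
  have int\<zeta>: "integrable M (\<lambda>\<omega>. (\<Sum>k\<in>U. \<zeta> (Z \<omega>) $ k) * indicator V (X \<omega>))"
    if [measurable]: "V \<in> sets MX" for U V
    by (rule Bochner_Integration.integrable_bound[OF posterior_integrable[OF Z \<zeta>c, of U]])
      (auto simp: indicator_def)
  show ?thesis
  proof
    assume ae: "AE \<omega> in M. \<zeta> (Z \<omega>) = \<eta> (X \<omega>, Z \<omega>)"
    have "AE \<omega> in M. real_cond_exp M F (\<lambda>\<omega>. indicator U (Y \<omega>) * indicator V (X \<omega>)) \<omega> =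
       real_cond_exp M F (\<lambda>\<omega>. indicator U (Y \<omega>)) \<omega> * real_cond_exp M F (\<lambda>\<omega>. indicator V (X \<omega>)) \<omega>"
      if V [measurable]: "V \<in> sets MX" for U V
    proof -
      let ?f = "\<lambda>\<omega>. indicator U (Y \<omega>) * indicator V (X \<omega>) :: real"
      have V_G: "(\<lambda>\<omega>. indicator V (X \<omega>) :: real) \<in> borel_measurable G"
        by (rule measurable_compose[OF X_G]) measurable
      \<comment> \<open>Given \<open>G\<close> the indicator of \<open>V\<close> is known and pulls
        out; the remaining factor is \<open>\<eta>\<close>, replaced by \<open>\<zeta>\<close>
        through \<open>ae\<close>.\<close>
      have "AE \<omega> in M. real_cond_exp M G ?f \<omega> = (\<Sum>k\<in>U. \<zeta> (Z \<omega>) $ k) * indicator V (X \<omega>)"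
        using G.real_cond_exp_mult[OF V_G, of "\<lambda>\<omega>. indicator U (Y \<omega>)"] intY[OF V, of U] ceG[of U] ae
        by (auto simp: mult.commute S_def elim!: eventually_elim2)
      then have 1: "AE \<omega> in M. real_cond_exp M F (real_cond_exp M G ?f) \<omega> =
          real_cond_exp M F (\<lambda>\<omega>. (\<Sum>k\<in>U. \<zeta> (Z \<omega>) $ k) * indicator V (X \<omega>)) \<omega>"
        by (intro F.real_cond_exp_cong) auto
      \<comment> \<open>Now \<open>\<zeta>\<close> is the \<open>F\<close>-measurable factor that
        pulls out.\<close>
      have 2: "AE \<omega> in M. real_cond_exp M F (\<lambda>\<omega>. (\<Sum>k\<in>U. \<zeta> (Z \<omega>) $ k) * indicator V (X \<omega>)) \<omega> =
          (\<Sum>k\<in>U. \<zeta> (Z \<omega>) $ k) * real_cond_exp M F (\<lambda>\<omega>. indicator V (X \<omega>)) \<omega>"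
        by (rule F.real_cond_exp_mult[OF \<zeta>_F _ int\<zeta>[OF V]]) measurable
      show ?thesis
        using F.real_cond_exp_nested_subalg[OF MG GF intY[OF V, of U]] 1 2 ceF[of U]
        by eventually_elim simp
    qed
    then show "cond_indep M (count_space UNIV) MX MZ Y X Z"
      unfolding cond_indep_def Let_def F_def by blast
  next
    assume ci: "cond_indep M (count_space UNIV) MX MZ Y X Z"
    have "AE \<omega> in M. \<zeta> (Z \<omega>) $ k = \<eta> (S \<omega>) $ k" for k
    proof -
      \<comment> \<open>\<open>\<zeta>\<close> disintegrates the joint law of \<open>(X, Y, Z)\<close> on rectangles, which generate.\<close>
      have rect: "(\<integral>\<omega>. \<zeta> (Z \<omega>) $ k * indicator (V \<times> C) (S \<omega>) \<partial>M) =
          (\<integral>\<omega>. indicator {k} (Y \<omega>) * indicator (V \<times> C) (S \<omega>) \<partial>M)"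
        if V [measurable]: "V \<in> sets MX" and C [measurable]: "C \<in> sets MZ" for V C
      proof -
        let ?f = "\<lambda>\<omega>. indicator {k} (Y \<omega>) * indicator V (X \<omega>) :: real"
        have C_F: "(\<lambda>\<omega>. indicator C (Z \<omega>) :: real) \<in> borel_measurable F"
          unfolding F_def by (rule measurable_vimage_algebra_compose[OF Z]) measurable
        have \<zeta>C_F: "(\<lambda>\<omega>. indicator C (Z \<omega>) * (\<zeta> (Z \<omega>) $ k)) \<in> borel_measurable F"
          unfolding F_def by (rule measurable_vimage_algebra_compose[OF Z]) measurable
        have "(\<integral>\<omega>. indicator {k} (Y \<omega>) * indicator (V \<times> C) (S \<omega>) \<partial>M) = (\<integral>\<omega>. indicator C (Z \<omega>) * ?f \<omega> \<partial>M)"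
          by (intro Bochner_Integration.integral_cong) (auto simp: S_def indicator_def)
        also have "\<dots> = (\<integral>\<omega>. indicator C (Z \<omega>) * real_cond_exp M F ?f \<omega> \<partial>M)"
          by (rule F.real_cond_exp_intg(2)[symmetric, OF _ C_F])
            (auto intro!: integrable_const_bound[where B=1] simp: indicator_def)
        also have "\<dots> = (\<integral>\<omega>. (indicator C (Z \<omega>) * (\<zeta> (Z \<omega>) $ k)) *
            real_cond_exp M F (\<lambda>\<omega>. indicator V (X \<omega>)) \<omega> \<partial>M)"
        proof (rule integral_cong_AE)
          have "AE \<omega> in M. real_cond_exp M F ?f \<omega> =
              real_cond_exp M F (\<lambda>\<omega>. indicator {k} (Y \<omega>)) \<omega> * real_cond_exp M F (\<lambda>\<omega>. indicator V (X \<omega>)) \<omega>"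
            using ci V unfolding cond_indep_def Let_def F_def by auto
          then show "AE \<omega> in M. indicator C (Z \<omega>) * real_cond_exp M F ?f \<omega> =
              (indicator C (Z \<omega>) * (\<zeta> (Z \<omega>) $ k)) * real_cond_exp M F (\<lambda>\<omega>. indicator V (X \<omega>)) \<omega>"
            using ceF[of "{k}"] by eventually_elim simp
        qed measurable
        \<comment> \<open>The weight in front is \<open>F\<close>-measurable, so integrating against
          it removes the conditional expectation of the indicator of \<open>V\<close>.\<close>
        also have "\<dots> = (\<integral>\<omega>. (indicator C (Z \<omega>) * (\<zeta> (Z \<omega>) $ k)) * indicator V (X \<omega>) \<partial>M)"
        proof (rule F.real_cond_exp_intg(2)[OF _ \<zeta>C_F])
          show "integrable M (\<lambda>\<omega>. (indicator C (Z \<omega>) * (\<zeta> (Z \<omega>) $ k)) * indicator V (X \<omega>))"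
            using prob_simplex_nonneg[OF cond_pmfs_simplex[OF \<zeta>c]] prob_simplex_le_1[OF cond_pmfs_simplex[OF \<zeta>c]]
              measurable_space[OF Z]
            by (intro integrable_const_bound[where B=1] AE_I2) (auto simp: indicator_def)
        qed measurable
        also have "\<dots> = (\<integral>\<omega>. \<zeta> (Z \<omega>) $ k * indicator (V \<times> C) (S \<omega>) \<partial>M)"
          by (intro Bochner_Integration.integral_cong) (auto simp: S_def indicator_def)
        finally show ?thesis by simp
      qed
      \<comment> \<open>\<open>?B\<close> is the law of \<open>S\<close> restricted to
        \<open>Y = k\<close>, and \<open>?A\<close> is its candidate built from
        \<open>\<zeta>\<close>; by \<open>rect\<close> they agree on an intersection-stable
        generator.\<close>
      let ?A = "density (distr M N S) (\<lambda>s. ennreal (\<zeta> (snd s) $ k))"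
      let ?B = "density (distr M N S) (\<lambda>s. ennreal (\<eta> s $ k))"
      let ?E = "{V \<times> C | V C. V \<in> sets MX \<and> C \<in> sets MZ}"
      have emA: "emeasure ?A R = ennreal (\<integral>\<omega>. \<zeta> (Z \<omega>) $ k * indicator R (S \<omega>) \<partial>M)"
        if [measurable]: "R \<in> sets N" for R
      proof -
        have "emeasure ?A R = (\<integral>\<^sup>+\<omega>. ennreal (\<zeta> (Z \<omega>) $ k * indicator R (S \<omega>)) \<partial>M)"
          by (simp add: emeasure_density nn_integral_distr snd_S ennreal_mult'' ennreal_indicator)
        also have "\<dots> = ennreal (\<integral>\<omega>. \<zeta> (Z \<omega>) $ k * indicator R (S \<omega>) \<partial>M)"
          using prob_simplex_nonneg[OF cond_pmfs_simplex[OF \<zeta>c]] prob_simplex_le_1[OF cond_pmfs_simplex[OF \<zeta>c]]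
              measurable_space[OF Z]
          by (intro nn_integral_eq_integral integrable_const_bound[where B=1] AE_I2) (auto simp: indicator_def)
        finally show ?thesis .
      qed
      have emB: "emeasure ?B R = ennreal (\<integral>\<omega>. indicator {k} (Y \<omega>) * indicator R (S \<omega>) \<partial>M)"
        if [measurable]: "R \<in> sets N" for R
      proof -
        have "emeasure ?B R = (\<integral>\<^sup>+s. indicator R s \<partial>distr (density M (\<lambda>\<omega>. indicator {k} (Y \<omega>))) N S)"
          using \<eta>S by (simp add: posterior_def)
        also have "\<dots> = (\<integral>\<^sup>+\<omega>. indicator {k} (Y \<omega>) * indicator R (S \<omega>) \<partial>M)"
          by (subst nn_integral_distr) (simp_all add: nn_integral_density del: nn_integral_indicator)
        also have "\<dots> = (\<integral>\<^sup>+\<omega>. ennreal (indicator {k} (Y \<omega>) * indicator R (S \<omega>)) \<partial>M)"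
          by (simp add: ennreal_mult'' ennreal_indicator)
        also have "\<dots> = ennreal (\<integral>\<omega>. indicator {k} (Y \<omega>) * indicator R (S \<omega>) \<partial>M)"
          by (intro nn_integral_eq_integral integrable_const_bound[where B=1] AE_I2) (auto simp: indicator_def)
        finally show ?thesis .
      qed
      have E_N: "V \<times> C \<in> sets N" if "V \<in> sets MX" "C \<in> sets MZ" for V C
        using that by (simp add: N_def)
      have "?A = ?B"
      proof (rule measure_eqI_generator_eq[OF Int_stable_pair_measure_generator])
        show "?E \<subseteq> Pow (space MX \<times> space MZ)"
          using sets.space_closed[of MX] sets.space_closed[of MZ] by auto
        show "emeasure ?A R = emeasure ?B R" if "R \<in> ?E" for R
          using that E_N rect by (auto simp: emA emB)
        show "sets ?A = sigma_sets (space MX \<times> space MZ) ?E" "sets ?B = sigma_sets (space MX \<times> space MZ) ?E"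
          by (simp_all add: N_def sets_pair_measure)
        show "range (\<lambda>_::nat. space MX \<times> space MZ) \<subseteq> ?E" by auto
        show "(\<Union>i::nat. space MX \<times> space MZ) = space MX \<times> space MZ" by simp
        show "emeasure ?A (space MX \<times> space MZ) \<noteq> \<infinity>" by (simp add: emA E_N)
      qed
      interpret dS: prob_space "distr M N S" by (rule prob_space_distr) simp
      have "AE s in distr M N S. ennreal (\<zeta> (snd s) $ k) = ennreal (\<eta> s $ k)"
        using \<open>?A = ?B\<close> by (intro dS.density_unique) auto
      then have "AE \<omega> in M. ennreal (\<zeta> (snd (S \<omega>)) $ k) = ennreal (\<eta> (S \<omega>) $ k)"
        by (subst (asm) AE_distr_iff) auto
      then show ?thesis using AE_space
      proof eventually_elim
        case (elim \<omega>)
        then show ?case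
          using prob_simplex_nonneg[OF cond_pmfs_simplex[OF \<zeta>c measurable_space[OF Z elim(2)]]]
            prob_simplex_nonneg[OF cond_pmfs_simplex[OF \<eta>c measurable_space[OF S elim(2)]]]
          by (simp add: S_def)
      qed
    qed
    then have "AE \<omega> in M. \<forall>k. \<zeta> (Z \<omega>) $ k = \<eta> (S \<omega>) $ k"
      by (simp add: AE_all_countable)
    then show "AE \<omega> in M. \<zeta> (Z \<omega>) = \<eta> (X \<omega>, Z \<omega>)"
      by (simp add: vec_eq_iff S_def)
  qed
qed

end

subsection \<open>Information gain\<close>

context prob_space
begin

text \<open>Conditional mutual information is the difference of two mutual informations, in which
  the entropy of \<open>Y\<close> cancels. Nonnegativity is data processing along
  \<open>snd\<close>.\<close>

lemma information_gain:
  fixes Y :: "'a \<Rightarrow> 'k::finite"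
  assumes Y: "Y \<in> measurable M (count_space UNIV)"
    and X [measurable]: "X \<in> measurable M MX" and Z [measurable]: "Z \<in> measurable M MZ"
  defines "I \<equiv> conditional_mutual_information (exp 1) (count_space UNIV) MX MZ Y X Z"
  shows "enn2ereal (min_log_risk M MZ Y Z) - enn2ereal (min_log_risk M (MZ \<Otimes>\<^sub>M MX) Y (\<lambda>\<omega>. (Z \<omega>, X \<omega>))) = ereal I"
    and "0 \<le> I" and "I = 0 \<longleftrightarrow> cond_indep M (count_space UNIV) MX MZ Y X Z"
proof -
  let ?N = "MX \<Otimes>\<^sub>M MZ"
  define S where "S = (\<lambda>\<omega>. (X \<omega>, Z \<omega>))"
  define a where "a = min_log_risk M MZ Y Z"
  define b where "b = min_log_risk M ?N Y S"
  have S: "S \<in> measurable M ?N" unfolding S_def by measurable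
  \<comment> \<open>The library conditions on pairs in the order \<open>(X, Z)\<close>, the statement uses \<open>(Z, X)\<close>.\<close>
  have swap: "min_log_risk M (MZ \<Otimes>\<^sub>M MX) Y (\<lambda>\<omega>. (Z \<omega>, X \<omega>)) = b"
    unfolding b_def S_def
    using min_log_risk_compose_le[of "\<lambda>(x, z). (z, x)" ?N "MZ \<Otimes>\<^sub>M MX" "\<lambda>\<omega>. (X \<omega>, Z \<omega>)" Y]
      min_log_risk_compose_le[of "\<lambda>(x, z). (z, x)" "MZ \<Otimes>\<^sub>M MX" ?N "\<lambda>\<omega>. (Z \<omega>, X \<omega>)" Y]
    by (intro antisym) (simp_all add: measurable_pair_swap')
  have fin: "a < \<infinity>" "b < \<infinity>"
    unfolding a_def b_def using min_log_risk_finite[OF Y Z] min_log_risk_finite[OF Y S] by auto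
  have le: "b \<le> a"
    using min_log_risk_compose_le[OF _ S, of snd MZ Y] by (simp add: a_def b_def S_def)
  have I: "I = enn2real a - enn2real b"
    unfolding I_def conditional_mutual_information_def a_def b_def
    using mutual_information_posterior[OF Y Z] mutual_information_posterior[OF Y S]
    by (simp add: S_def)
  \<comment> \<open>Finiteness of both risks lets the extended difference be computed in the
    reals.\<close>
  have ab: "a = ennreal (enn2real a)" "b = ennreal (enn2real b)"
    using fin by auto
  show "enn2ereal (min_log_risk M MZ Y Z) - enn2ereal (min_log_risk M (MZ \<Otimes>\<^sub>M MX) Y (\<lambda>\<omega>. (Z \<omega>, X \<omega>))) = ereal I"
    unfolding swap a_def[symmetric] I by (subst ab(1), subst ab(2)) (simp add: enn2ereal_ennreal)
  show "0 \<le> I"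
    unfolding I using le fin by (simp add: enn2real_mono)
  obtain \<eta> where \<eta>: "posterior M ?N Y S \<eta>" using posterior_exists[OF Y S] .
  obtain \<zeta> where \<zeta>: "posterior M MZ Y Z \<zeta>" using posterior_exists[OF Y Z] .
  have \<zeta>_snd: "(\<lambda>s. \<zeta> (snd s)) \<in> cond_pmfs ?N"
    using \<zeta> by (auto simp: posterior_def cond_pmfs_def space_pair_measure)
  have "I = 0 \<longleftrightarrow> a = b"
    unfolding I using ab by (metis eq_iff_diff_eq_0)
  \<comment> \<open>Composed with \<open>snd\<close>, \<open>\<zeta>\<close> has on \<open>S\<close>
    the risk it has on \<open>Z\<close>, so equal minima mean that it is already optimal given the
    pair.\<close>
  also have "\<dots> \<longleftrightarrow> log_risk M Y S (\<lambda>s. \<zeta> (snd s)) = log_risk M Y S \<eta>"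
    unfolding a_def b_def min_log_risk_eq_posterior[OF Y S \<eta>] min_log_risk_eq_posterior[OF Y Z \<zeta>]
    by (simp add: log_risk_def S_def)
  also have "\<dots> \<longleftrightarrow> (AE \<omega> in M. \<zeta> (Z \<omega>) = \<eta> (X \<omega>, Z \<omega>))"
    using log_risk_minimal_iff[OF Y S \<eta> \<zeta>_snd] by (simp add: S_def)
  also have "\<dots> \<longleftrightarrow> cond_indep M (count_space UNIV) MX MZ Y X Z"
    using cond_indep_posterior_iff[OF Y X Z \<eta>[unfolded S_def] \<zeta>] by simp
  finally show "I = 0 \<longleftrightarrow> cond_indep M (count_space UNIV) MX MZ Y X Z" .
qed

end

text \<open>The risks live in \<open>ennreal\<close>, where subtraction truncates at zero; passing
  to \<open>ereal\<close> keeps the sign of the difference meaningful.\<close>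

theorem proposition1:
  fixes P :: "'w measure"
    and X :: "'w \<Rightarrow> 'x::euclidean_space"
    and Y :: "'w \<Rightarrow> 'k::finite"
    and Z :: "'w \<Rightarrow> 'z"
    and MZ :: "'z measure"
    and \<pi>g \<pi>l :: "'w \<Rightarrow> real ^ 'k"
    and Rg Rl \<Delta> D :: real
  assumes "prob_space P"
    and "CARD('k) \<ge> 2"
    and "X \<in> borel_measurable P"
    and "Y \<in> measurable P (count_space UNIV)"
    and "standard_borel MZ"
    and "Z \<in> measurable P MZ"
    and "\<pi>g \<in> borel_measurable P" and "\<forall>\<omega>\<in>space P. \<pi>g \<omega> \<in> prob_simplex"
    and "\<pi>l \<in> borel_measurable P" and "\<forall>\<omega>\<in>space P. \<pi>l \<omega> \<in> prob_simplex"
    and "Rg = brier_risk P Y \<pi>g"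
    and "Rl = brier_risk P Y \<pi>l"
    and "\<Delta> = Rl - Rg"
    and "D = (\<integral>\<omega>. (norm (\<pi>g \<omega> - \<pi>l \<omega>))\<^sup>2 \<partial>P)"
  shows
    "(let I = prob_space.conditional_mutual_information P (exp 1)
                (count_space UNIV) borel MZ Y X Z
      in enn2ereal (min_log_risk P MZ Y Z)
           - enn2ereal (min_log_risk P (MZ \<Otimes>\<^sub>M borel) Y (\<lambda>\<omega>. (Z \<omega>, X \<omega>))) = ereal I
         \<and> I \<ge> 0
         \<and> (I = 0 \<longleftrightarrow> cond_indep P (count_space UNIV) borel MZ Y X Z))
     \<and> (\<forall>\<alpha>\<in>{0..1}. brier_risk P Y (mixture \<alpha> \<pi>g \<pi>l) - Rg = \<alpha> * (\<Delta> - D) + \<alpha>\<^sup>2 * D)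
     \<and> (\<Delta> \<ge> 0 \<longrightarrow>
         ((\<exists>\<alpha>\<in>{0<..1}. brier_risk P Y (mixture \<alpha> \<pi>g \<pi>l) < Rg) \<longleftrightarrow> D > \<Delta>)
         \<and> (D > \<Delta> \<longrightarrow>
              Rg - brier_risk P Y (mixture ((D - \<Delta>) / (2 * D)) \<pi>g \<pi>l) = (D - \<Delta>)\<^sup>2 / (4 * D)
              \<and> (D - \<Delta>)\<^sup>2 / (4 * D) > 0))"
proof -
  interpret prob_space P by fact
  note Y = assms(4) and X = assms(3) and Z = assms(6) and g = assms(7,8) and l = assms(9,10)
  have D: "0 \<le> D" unfolding assms(14) by simp
  \<comment> \<open>Proved for every real weight, so it applies at the vertex without a range
    check.\<close>
  have mix: "brier_risk P Y (mixture \<alpha> \<pi>g \<pi>l) - Rg = \<alpha> * (\<Delta> - D) + \<alpha>\<^sup>2 * D" for \<alpha>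
    using brier_risk_mixture[OF Y g l assms(14), of \<alpha>] assms(11-13) by simp
  have gain: "Rg - brier_risk P Y (mixture ((D - \<Delta>) / (2 * D)) \<pi>g \<pi>l) = (D - \<Delta>)\<^sup>2 / (4 * D)"
    and gain_pos: "(D - \<Delta>)\<^sup>2 / (4 * D) > 0" if "0 \<le> \<Delta>" "D > \<Delta>"
    using mix[of "(D - \<Delta>) / (2 * D)"] quadratic_gain(2)[OF that]
    unfolding quadratic_gain(1)[OF that] by auto
  have iff: "(\<exists>\<alpha>\<in>{0<..1}. brier_risk P Y (mixture \<alpha> \<pi>g \<pi>l) < Rg) \<longleftrightarrow> D > \<Delta>" if "0 \<le> \<Delta>"
    unfolding quadratic_gain_iff[OF D that, symmetric] mix[symmetric] by simp
  show ?thesis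
    using information_gain[OF Y X Z] mix gain gain_pos iff by (simp add: Let_def)
qed

end
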